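(* Let $\mathcal{L}$ be a finite meet-semilattice, and let $\mathcal{G}_1$ and $\mathcal{G}_2=\mathcal{G}_1\cup\{b\}$, with $b\notin\mathcal{G}_1$, be building sets of $\mathcal{L}$. Let $R$ be a commutative ring, $\chi:N(\mathcal{G}_1)\to\mathbb{Z}$ any function, and $\alpha:\mathcal{G}_2\to R^\times$ a function such that $\alpha(b)=\sum_{F\in F_{\mathcal{G}_1}(b)}\alpha(F)$. Then $$Z_{\mathcal{L}}^{\mathcal{G}_1,\chi,\alpha}=Z_{\mathcal{L}}^{\mathcal{G}_2,Bl_b\chi,\alpha},$$ where on the left $\alpha$ is restricted to $\mathcal{G}_1$.
   Context: All posets are finite. For $S\subset\mathcal{L}$, $x\in\mathcal{L}$, $S_{\le x}=\{y\in S:y\le x\}$; $\max S$ is the set of maximal elements; $\bigvee T$ is the join of $T$ when it exists. A meet-semilattice has a least element $\hat 0$; $[a,b]=\{x:a\le x\le b\}$; products of posets carry the componentwise order. A subset $\mathcal{G}\subset\mathcal{L}\setminus\{\hat0\}$ is a building set if for every $p\in\mathcal{L}\setminus\{\hat0\}$ there is a poset isomorphism $\phi:[\hat0,p]\to\prod_{g\in F_{\mathcal{G}}(p)}[\hat0,g]$ with $\phi(g)=(\hat0,\dots,g,\dots,\hat0)$ ($g$ in the $g$-th coordinate) for all $g\in F_{\mathcal{G}}(p)$, where $F_{\mathcal{G}}(p)=\max\{g\in\mathcal{G}: g\le p\}$. The nested set complex $N(\mathcal{G})$ is the set of all subsets $S\subset\mathcal{G}$ (including $\emptyset$) such that for every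 $T\subset S$ with $|T|\ge2$ of pairwise incomparable elements, $\bigvee T$ exists and $\bigvee T\notin\mathcal{G}$. For a building set $\mathcal{G}$, a function $\chi:N(\mathcal{G})\to\mathbb{Z}$ and a function $\alpha:\mathcal{G}\to R^\times$ ($R$ a commutative ring), define $$Z_{\mathcal{L}}^{\mathcal{G},\chi,\alpha}=\sum_{U\in N(\mathcal{G})}\chi^\circ(U)\prod_{A\in U}\alpha(A)^{-1},\qquad \chi^\circ(U)=\sum_{T\in N(\mathcal{G}),\,T\supseteq U}(-1)^{|T|-|U|}\chi(T).$$ For building sets $\mathcal{G}_1$, $\mathcal{G}_2=\mathcal{G}_1\cup\{b\}$ ($b\notin\mathcal{G}_1$), write $F=F_{\mathcal{G}_1}(b)$; for $f:N(\mathcal{G}_1)\to\mathbb{Z}$ the function $Bl_bf:N(\mathcal{G}_2)\to\mathbb{Z}$ is defined by: $Bl_bf(S)=f(S)$ if $b\notin S$ and $S\cup F\notin N(\mathcal{G}_1)$; $Bl_bf(S)=f(S)+f(S\cup F)(|F\setminus S|-1)$ if $b\notin S$ and $S\cup F\in N(\mathcal{G}_1)$; $Bl_bf(S)=f(S\setminus\{b\}\cup F)\,|F\setminus S|$ if $b\in S$. *)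

theory Defs
  imports "HOL-Algebra.Ring" "HOL-Library.Lub_Glb"
begin

definition maximal_elements :: "'a::order set \<Rightarrow> 'a set" where
  "maximal_elements S = {x \<in> S. \<forall>y\<in>S. x \<le> y \<longrightarrow> y = x}"

definition factors :: "'a::order set \<Rightarrow> 'a \<Rightarrow> 'a set" where
  "factors G p = maximal_elements {g \<in> G. g \<le> p}"

text \<open>The product of the intervals below the factors is the set of extensional functions
  on the set of factors, with the componentwise order.\<close>

definition building_set :: "'a::{semilattice_inf, order_bot} set \<Rightarrow> bool" where
  "building_set G \<longleftrightarrow>
     G \<subseteq> UNIV - {bot} \<and>
     (\<forall>p. p \<noteq> bot \<longrightarrow>
       (\<exists>\<phi>. bij_betw \<phi> {bot..p} (\<Pi>\<^sub>E g\<in>factors G p. {bot..g}) \<and>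
            (\<forall>x\<in>{bot..p}. \<forall>y\<in>{bot..p}. x \<le> y \<longleftrightarrow> (\<forall>g\<in>factors G p. \<phi> x g \<le> \<phi> y g)) \<and>
            (\<forall>g\<in>factors G p. \<forall>h\<in>factors G p. \<phi> g h = (if h = g then g else bot))))"

definition nested_complex :: "'a::order set \<Rightarrow> 'a set set" where
  "nested_complex G =
     {S. S \<subseteq> G \<and>
         (\<forall>T\<subseteq>S. card T \<ge> 2 \<and> pairwise (\<lambda>x y. \<not> x \<le> y \<and> \<not> y \<le> x) T \<longrightarrow>
                (\<exists>j. isLub UNIV T j \<and> j \<notin> G))}"

text \<open>Functions on the nested set complex are represented by functions on all sets; only their
  values on nested sets are used below.\<close>

definition chi_circ :: "'a::order set \<Rightarrow> ('a set \<Rightarrow> int) \<Rightarrow> 'a set \<Rightarrow> int" where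
  "chi_circ G \<chi> U =
     (\<Sum>T\<in>{T \<in> nested_complex G. U \<subseteq> T}. (- 1) ^ (card T - card U) * \<chi> T)"

definition Z_fun ::
  "('r, 'm) ring_scheme \<Rightarrow> 'a::order set \<Rightarrow> ('a set \<Rightarrow> int) \<Rightarrow> ('a \<Rightarrow> 'r) \<Rightarrow> 'r" where
  "Z_fun R G \<chi> \<alpha> =
     (\<Oplus>\<^bsub>R\<^esub>U\<in>nested_complex G.
        [chi_circ G \<chi> U] \<cdot>\<^bsub>R\<^esub> (\<Otimes>\<^bsub>R\<^esub>A\<in>U. inv\<^bsub>R\<^esub> (\<alpha> A)))"

definition Bl :: "'a::order set \<Rightarrow> 'a \<Rightarrow> ('a set \<Rightarrow> int) \<Rightarrow> 'a set \<Rightarrow> int" where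
  "Bl G b f S =
     (let F = factors G b in
      if b \<in> S then f ((S - {b}) \<union> F) * int (card (F - S))
      else if S \<union> F \<in> nested_complex G then f S + f (S \<union> F) * (int (card (F - S)) - 1)
      else f S)"

end

theory Submission imports Defs begin

text \<open>Since nested set complexes are closed under subsets, exchanging the two sums gives
  \<open>Z = (\<Sum>T. \<chi> T * w T)\<close>, where \<open>w T\<close> is the product of \<open>1 / \<alpha> A - 1\<close> over \<open>A \<in> T\<close>.
  The complex of \<open>G \<union> {b}\<close> is the stellar subdivision of the complex of \<open>G\<close> at the simplex \<open>F\<close>
  of factors of \<open>b\<close>. Comparing the coefficients of \<open>\<chi> T\<close> for \<open>F \<subseteq> T\<close> reduces the claim to
  \<open>(\<Sum>P\<subset>F. (card (F - P) - 1) * w P + card (F - P) * w {b} * w P) = w F\<close>, which follows from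
  \<open>(\<Sum>P\<subseteq>F. w P) = (\<Prod>A\<in>F. 1 / \<alpha> A)\<close> and
  \<open>(\<Sum>P\<subseteq>F. card (F - P) * w P) = (\<Sum>A\<in>F. \<alpha> A) * (\<Prod>A\<in>F. 1 / \<alpha> A)\<close>.\<close>

section \<open>Joins, antichains and factors in a finite meet-semilattice\<close>

lemma isLub_UNIV_iff:
  "isLub UNIV T j \<longleftrightarrow> (\<forall>t\<in>T. t \<le> j) \<and> (\<forall>u. (\<forall>t\<in>T. t \<le> u) \<longrightarrow> j \<le> u)"
  unfolding isLub_def leastP_def isUb_def setge_def setle_def by auto

text \<open>The upper bounds form a finite nonempty set whose meet is again an upper bound, hence
  the least one.\<close>

lemma bounded_imp_isLub:
  fixes T :: "'a::{finite, semilattice_inf} set"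
  assumes "\<And>t. t \<in> T \<Longrightarrow> t \<le> u"
  shows "\<exists>j. isLub UNIV T j"
proof -
  let ?U = "{v. \<forall>t\<in>T. t \<le> v}"
  have "?U \<noteq> {}" using assms by auto
  then have "isLub UNIV T (Inf_fin ?U)"
    unfolding isLub_UNIV_iff by (auto intro!: Inf_fin.boundedI intro: Inf_fin.coboundedI)
  then show ?thesis by blast
qed

abbreviation antichain :: "'a::order set \<Rightarrow> bool" where
  "antichain T \<equiv> pairwise (\<lambda>x y. \<not> x \<le> y \<and> \<not> y \<le> x) T"

lemma antichainD: "antichain T \<Longrightarrow> x \<in> T \<Longrightarrow> y \<in> T \<Longrightarrow> x \<le> y \<Longrightarrow> x = y"
  unfolding pairwise_def by blast

lemma factors_above:
  fixes G :: "'a::{finite, order} set"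
  assumes "x \<in> G" "x \<le> p"
  shows "\<exists>g\<in>factors G p. x \<le> g"
proof -
  have "finite {g \<in> G. g \<le> p}" by simp
  from finite_has_maximal2[OF this, of x] assms show ?thesis
    unfolding factors_def maximal_elements_def by auto
qed

lemma factorsD: "g \<in> factors G p \<Longrightarrow> g \<in> G" "g \<in> factors G p \<Longrightarrow> g \<le> p"
  unfolding factors_def maximal_elements_def by auto

lemma antichain_factors: "antichain (factors G p)"
  unfolding factors_def maximal_elements_def pairwise_def by auto

lemma building_set_neq_bot: "building_set G \<Longrightarrow> g \<in> G \<Longrightarrow> g \<noteq> bot"
  unfolding building_set_def by auto

section \<open>Joins and coordinates in a building set decomposition\<close>

text \<open>If \<open>u\<close> bounds all factors, then \<open>inf u p\<close> lies above each
  factor \<open>g\<close>, so its \<open>g\<close>-coordinate is at least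
  \<open>\<phi> g g = g\<close>, the largest possible value. Hence it dominates \<open>p\<close> in
  every coordinate. The detour through \<open>inf u p\<close> is made because \<open>\<phi>\<close>
  is controlled only below \<open>p\<close>.\<close>

lemma isLub_factors:
  fixes p :: "'a::{semilattice_inf, order_bot}"
  assumes "building_set G" "p \<noteq> bot"
  shows "isLub UNIV (factors G p) p"
  unfolding isLub_UNIV_iff
proof (intro conjI ballI allI impI)
  show "t \<le> p" if "t \<in> factors G p" for t using that factorsD by blast
  fix u assume u: "\<forall>t\<in>factors G p. t \<le> u"
  obtain \<phi> where bij: "bij_betw \<phi> {bot..p} (\<Pi>\<^sub>E g\<in>factors G p. {bot..g})"
    and ord: "\<And>x y. x \<le> p \<Longrightarrow> y \<le> p \<Longrightarrow> x \<le> y \<longleftrightarrow> (\<forall>g\<in>factors G p. \<phi> x g \<le> \<phi> y g)"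
    and unit: "\<And>g h. g \<in> factors G p \<Longrightarrow> h \<in> factors G p \<Longrightarrow> \<phi> g h = (if h = g then g else bot)"
    using assms unfolding building_set_def by (simp add: Ball_def) metis
  have "\<phi> p g \<le> \<phi> (inf u p) g" if g: "g \<in> factors G p" for g
  proof -
    have "\<phi> p \<in> (\<Pi>\<^sub>E g\<in>factors G p. {bot..g})" using bij by (auto simp: bij_betw_def)
    then have "\<phi> p g \<le> \<phi> g g" using g unit by (auto simp: PiE_iff)
    also have "\<dots> \<le> \<phi> (inf u p) g"
      using ord[of g "inf u p"] g u factorsD(2)[OF g] by auto
    finally show ?thesis .
  qed
  then have "p \<le> inf u p" using ord[of p "inf u p"] by simp
  then show "p \<le> u" by simp
qed

text \<open>The element x below has coordinate v in direction g and is maximal in all others.\<close>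

lemma building_set_slice:
  fixes p :: "'a::{semilattice_inf, order_bot}"
  assumes "building_set G" "p \<noteq> bot" and g: "g \<in> factors G p" and v: "v \<le> g"
  obtains x where "v \<le> x" "\<And>h. h \<in> factors G p \<Longrightarrow> h \<noteq> g \<Longrightarrow> h \<le> x"
    "\<And>y. y \<le> g \<Longrightarrow> y \<le> x \<Longrightarrow> y \<le> v"
proof -
  let ?P = "\<Pi>\<^sub>E g\<in>factors G p. {bot..g}"
  obtain \<phi> where bij: "bij_betw \<phi> {bot..p} ?P"
    and ord: "\<And>x y. x \<le> p \<Longrightarrow> y \<le> p \<Longrightarrow> x \<le> y \<longleftrightarrow> (\<forall>g\<in>factors G p. \<phi> x g \<le> \<phi> y g)"
    and unit: "\<And>g h. g \<in> factors G p \<Longrightarrow> h \<in> factors G p \<Longrightarrow> \<phi> g h = (if h = g then g else bot)"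
    using assms unfolding building_set_def by (simp add: Ball_def) metis
  have mem: "\<phi> x h \<le> h" if "x \<le> p" "h \<in> factors G p" for x h
    using bij that by (force simp: bij_betw_def PiE_iff)
  have gp: "g \<le> p" using g by (rule factorsD)
  have zero: "\<phi> y h = bot" if "y \<le> g" "h \<in> factors G p" "h \<noteq> g" for y h
  proof -
    have "\<phi> y h \<le> \<phi> g h" using ord[of y g] that gp by auto
    then show ?thesis using unit that g by (simp add: bot_unique)
  qed
  \<comment> \<open>The \<open>g\<close>-coordinate is \<open>\<phi> v g\<close> and not
    \<open>v\<close>, since the isomorphism is prescribed only at the factors and may act on
    \<open>{bot..g}\<close> by a nontrivial automorphism. By \<open>zero\<close>, elements below
    \<open>g\<close> are compared through their \<open>g\<close>-coordinate alone.\<close>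
  define f where "f = (\<lambda>h\<in>factors G p. if h = g then \<phi> v g else h)"
  have "f \<in> ?P" using mem[of v g] v gp g by (auto simp: f_def PiE_iff)
  then have "f \<in> \<phi> ` {bot..p}" using bij by (simp add: bij_betw_def)
  then obtain x where x: "x \<le> p" "\<phi> x = f" by auto
  show thesis
  proof
    show "v \<le> x" using ord[of v x] x v gp mem[of v] by (auto simp: f_def)
    show "h \<le> x" if "h \<in> factors G p" "h \<noteq> g" for h
      using ord[of h x] x factorsD(2)[OF that(1)] unit that g by (auto simp: f_def)
    show "y \<le> v" if "y \<le> g" "y \<le> x" for y
    proof -
      have "y \<le> p" using that(1) gp by (rule order_trans)
      then have "\<phi> y g \<le> \<phi> x g" using ord[of y x] x(1) that(2) g by blast
      then have "\<phi> y g \<le> \<phi> v g" using x(2) g by (simp add: f_def)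
      then have "\<phi> y h \<le> \<phi> v h" if "h \<in> factors G p" for h
        using zero[of y h] that \<open>y \<le> g\<close> by (cases "h = g") auto
      then show ?thesis using ord[OF \<open>y \<le> p\<close>, of v] order_trans[OF v gp] by blast
    qed
  qed
qed

section \<open>Nested sets and their joins\<close>

lemma nested_complex_subset: "S \<in> nested_complex G \<Longrightarrow> U \<subseteq> S \<Longrightarrow> U \<in> nested_complex G"
  unfolding nested_complex_def by blast

lemma nested_complexI:
  assumes "S \<subseteq> G"
    "\<And>T. T \<subseteq> S \<Longrightarrow> card T \<ge> 2 \<Longrightarrow> antichain T \<Longrightarrow> \<exists>j. isLub UNIV T j \<and> j \<notin> G"
  shows "S \<in> nested_complex G"
  using assms unfolding nested_complex_def by blast

lemma isLub_inj: "isLub UNIV T j \<Longrightarrow> isLub UNIV T k \<Longrightarrow> j = (k::'a::order)"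
  unfolding isLub_UNIV_iff by (meson order_antisym)

lemma nested_complexD:
  assumes "S \<in> nested_complex G" "T \<subseteq> S" "card T \<ge> 2" "antichain T"
  shows "\<exists>j. isLub UNIV T j" "isLub UNIV T j \<Longrightarrow> j \<notin> G"
  using assms isLub_inj unfolding nested_complex_def by blast+

text \<open>Every \<open>t\<close> in \<open>T\<close> lies below some factor of \<open>p\<close>.
  For a factor \<open>g\<close>, the elements of \<open>T\<close> below \<open>g\<close> have join
  \<open>g\<close>; as \<open>g\<close> belongs to \<open>G\<close>, nestedness leaves room for only
  one such element, which is then \<open>g\<close> itself. So all factors lie in \<open>T\<close>,
  and the antichain property excludes anything further.\<close>

lemma nested_antichain_eq_factors:
  fixes G :: "'a::{finite, semilattice_inf, order_bot} set"
  assumes G: "building_set G" and T: "T \<in> nested_complex G" "antichain T"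
    and p: "isLub UNIV T p" "p \<noteq> bot"
  shows "T = factors G p"
proof -
  have TG: "T \<subseteq> G" using T unfolding nested_complex_def by auto
  have "\<exists>g\<in>factors G p. t \<le> g" if "t \<in> T" for t
  proof -
    have "t \<le> p" using p(1) that unfolding isLub_UNIV_iff by blast
    then show ?thesis using factors_above[of t G p] that TG by blast
  qed
  then obtain above where above: "\<And>t. t \<in> T \<Longrightarrow> above t \<in> factors G p \<and> t \<le> above t" by metis
  have gT: "g \<in> T" if g: "g \<in> factors G p" for g
  proof -
    let ?Tg = "{t \<in> T. t \<le> g}"
    have lub: "isLub UNIV ?Tg g"
      unfolding isLub_UNIV_iff
    proof (intro conjI allI impI)
      fix u assume u: "\<forall>t\<in>?Tg. t \<le> u"
      \<comment> \<open>This \<open>x\<close> bounds all of \<open>T\<close>: elements below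
        \<open>g\<close> lie below \<open>inf u g\<close>, and any other element lies below a factor
        different from \<open>g\<close>. Hence \<open>g \<le> p \<le> x\<close>, and the slice
        property turns this into \<open>g \<le> inf u g\<close>.\<close>
      obtain x where x: "inf u g \<le> x" "\<And>h. h \<in> factors G p \<Longrightarrow> h \<noteq> g \<Longrightarrow> h \<le> x"
        "\<And>y. y \<le> g \<Longrightarrow> y \<le> x \<Longrightarrow> y \<le> inf u g"
        using building_set_slice[OF G p(2) g, of "inf u g"] by auto
      have "t \<le> x" if "t \<in> T" for t
      proof (cases "t \<le> g")
        case True
        then have "t \<le> inf u g" using u that by auto
        then show ?thesis using x(1) by (rule order_trans)
      next
        case False
        then show ?thesis using above[OF that] x(2)[of "above t"] by (metis order_trans)
      qed
      then have "p \<le> x" using p unfolding isLub_UNIV_iff by blast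
      then have "g \<le> x" using factorsD(2)[OF g] by auto
      then show "g \<le> u" using x(3)[of g] by auto
    qed auto
    have "?Tg \<noteq> {}"
    proof
      assume e: "?Tg = {}"
      have "g \<le> bot" using lub unfolding e isLub_UNIV_iff by blast
      then show False using building_set_neq_bot[OF G factorsD(1)[OF g]] by (simp add: bot_unique)
    qed
    moreover have "\<not> card ?Tg \<ge> 2"
    proof
      assume c: "card ?Tg \<ge> 2"
      have "antichain ?Tg" using T(2) by (rule pairwise_subset) auto
      with nested_complexD(2)[OF T(1) _ c _ lub] factorsD(1)[OF g] show False by auto
    qed
    ultimately have "card ?Tg = 1" by (metis One_nat_def card_0_eq finite less_2_cases not_less)
    then obtain t where t: "?Tg = {t}" by (auto simp: card_1_singleton_iff)
    have "isLub UNIV {t} t" unfolding isLub_UNIV_iff by auto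
    with lub have "t = g" unfolding t by (rule isLub_inj[rotated])
    then show ?thesis using t by auto
  qed
  have "t \<in> factors G p" if "t \<in> T" for t
    using above[OF that] gT antichainD[OF T(2) that] by metis
  with gT show ?thesis by auto
qed

text \<open>The join of the factors is \<open>p\<close>: with no factor \<open>p\<close> would be
  \<open>bot\<close>, and with a single one it would be that factor, an element of
  \<open>G\<close>.\<close>

lemma card_factors_ge_2:
  fixes G :: "'a::{finite, semilattice_inf, order_bot} set"
  assumes "building_set G" "p \<noteq> bot" "p \<notin> G"
  shows "card (factors G p) \<ge> 2"
proof (rule ccontr)
  assume "\<not> ?thesis"
  then consider "factors G p = {}" | g where "factors G p = {g}"
    by (metis One_nat_def card_0_eq finite less_2_cases not_less card_1_singletonE)
  then show False
  proof cases
    case 1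
    with isLub_factors[OF assms(1,2)] have "p \<le> bot" unfolding isLub_UNIV_iff by blast
    then show False using assms(2) by (simp add: bot_unique)
  next
    case 2
    with isLub_factors[OF assms(1,2)] have "p = g" unfolding isLub_UNIV_iff by (auto intro: antisym)
    then show False using 2 assms(3) factorsD(1) by blast
  qed
qed

section \<open>The nested set complex after adding one element\<close>

context
  fixes G :: "'a::{finite, semilattice_inf, order_bot} set" and b :: 'a and F
  assumes G: "building_set G" and bG: "b \<notin> G" and Gb: "building_set (insert b G)"
  defines "F \<equiv> factors G b"
begin

lemma b_neq_bot: "b \<noteq> bot" using building_set_neq_bot[OF Gb] by simp

lemma F_lub: "isLub UNIV F b" unfolding F_def by (rule isLub_factors[OF G b_neq_bot])

lemma F_le: "f \<in> F \<Longrightarrow> f \<le> b" unfolding F_def by (rule factorsD)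

text \<open>Enlarging \<open>G\<close> by \<open>b\<close> newly forbids exactly the antichains with
  join \<open>b\<close>. Among nested antichains only \<open>F\<close> has this join, by
  \<open>nested_antichain_eq_factors\<close>, and \<open>F\<close> has at least two
  elements.\<close>

lemma nested_complex_insert_notin:
  assumes "b \<notin> S"
  shows "S \<in> nested_complex (insert b G) \<longleftrightarrow> S \<in> nested_complex G \<and> \<not> F \<subseteq> S"
proof
  assume S: "S \<in> nested_complex (insert b G)"
  then have "S \<in> nested_complex G" using assms unfolding nested_complex_def by auto
  moreover have "\<not> F \<subseteq> S"
    using nested_complexD(2)[OF S _ _ _ F_lub] card_factors_ge_2[OF G b_neq_bot bG] antichain_factors
    unfolding F_def by blast
  ultimately show "S \<in> nested_complex G \<and> \<not> F \<subseteq> S" by simp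
next
  assume S: "S \<in> nested_complex G \<and> \<not> F \<subseteq> S"
  show "S \<in> nested_complex (insert b G)"
  proof (rule nested_complexI)
    show "S \<subseteq> insert b G" using S unfolding nested_complex_def by auto
    fix T assume T: "T \<subseteq> S" "card T \<ge> 2" "antichain T"
    obtain j where j: "isLub UNIV T j" "j \<notin> G"
      using nested_complexD[of S G T] S T by blast
    have "j \<noteq> b"
      using nested_antichain_eq_factors[OF G nested_complex_subset T(3), of S b] S T j b_neq_bot
      unfolding F_def by blast
    then show "\<exists>j. isLub UNIV T j \<and> j \<notin> insert b G" using j by blast
  qed
qed

text \<open>The interesting antichains \<open>T\<close> are those that meet \<open>F\<close>.
  Replacing the part of \<open>T\<close> below \<open>b\<close> by \<open>b\<close> itself gives a
  nested antichain of the larger building set, which is the set of factors of its join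
  \<open>q\<close>. So \<open>T\<close> is bounded by \<open>q\<close> and has a join
  \<open>j\<close>. If \<open>j\<close> were in \<open>G\<close>, it would lie below one of these
  factors, and then \<open>T\<close> would have a greatest element, which is impossible for an
  antichain with two elements.\<close>

lemma nested_complex_union_factors:
  assumes "b \<notin> S" and Sb: "insert b S \<in> nested_complex (insert b G)"
  shows "S \<union> F \<in> nested_complex G"
proof (rule nested_complexI)
  have S: "S \<in> nested_complex G"
    using nested_complex_insert_notin assms nested_complex_subset[OF Sb, of S] by blast
  then show "S \<union> F \<subseteq> G" unfolding nested_complex_def F_def using factorsD by blast
  fix T assume T: "T \<subseteq> S \<union> F" "card T \<ge> 2" "antichain T"
  show "\<exists>j. isLub UNIV T j \<and> j \<notin> G"
  proof (cases "T \<subseteq> S")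
    case True
    then show ?thesis using nested_complexD[OF S _ T(2,3)] by blast
  next
    case False
    then obtain f where f: "f \<in> T" "f \<in> F" using T by auto
    have no_upper: False if "\<And>t. t \<in> T \<Longrightarrow> t \<le> x" "x \<in> T" for x
    proof -
      have "T \<subseteq> {x}" using antichainD[OF T(3)] that by blast
      then have "card T \<le> 1" by (metis card.empty card_mono finite.emptyI finite_insert is_singletonI is_singleton_altdef)
      then show False using T(2) by simp
    qed
    define A where "A = {t \<in> T. \<not> t \<le> b}"
    have AS: "A \<subseteq> S" using T(1) F_le unfolding A_def by auto
    \<comment> \<open>Otherwise \<open>f \<le> b \<le> a\<close> makes two elements of
      \<open>T\<close> comparable, forcing \<open>f = a\<close> and thus
      \<open>a \<le> b\<close>.\<close>
    have not_above: "\<not> b \<le> a" if "a \<in> A" for a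
    proof
      assume "b \<le> a"
      then have "f \<le> a" using F_le[OF f(2)] by simp
      then have "f = a" using antichainD[OF T(3) f(1)] that unfolding A_def by blast
      then show False using that F_le[OF f(2)] unfolding A_def by auto
    qed
    have anti: "antichain (insert b A)"
      using T(3) not_above unfolding A_def pairwise_insert pairwise_def by blast
    have "\<exists>q. isLub UNIV (insert b A) q \<and> insert b A = factors (insert b G) q"
    proof -
      have nest: "insert b A \<in> nested_complex (insert b G)"
        using nested_complex_subset[OF Sb, of "insert b A"] AS by auto
      \<comment> \<open>Nestedness provides joins only for antichains with at least two elements, so
        \<open>A = {}\<close> is treated apart, with \<open>q = b\<close>.\<close>
      have "\<exists>q. isLub UNIV (insert b A) q"
      proof (cases "A = {}")
        case True
        have "isLub UNIV {b} b" unfolding isLub_UNIV_iff by auto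
        then show ?thesis using True by auto
      next
        case False
        moreover have "b \<notin> A" unfolding A_def by auto
        ultimately have "card (insert b A) \<ge> 2" by (simp add: Suc_le_eq card_gt_0_iff)
        then show ?thesis using nested_complexD(1)[OF nest _ _ anti] by blast
      qed
      then obtain q where q: "isLub UNIV (insert b A) q" by blast
      then have "b \<le> q" unfolding isLub_UNIV_iff by blast
      then have "q \<noteq> bot" using b_neq_bot by (auto simp: bot_unique)
      then show ?thesis using nested_antichain_eq_factors[OF Gb nest anti q] q by blast
    qed
    then obtain q where q: "isLub UNIV (insert b A) q" "insert b A = factors (insert b G) q" by blast
    have Tq: "t \<le> q" if "t \<in> T" for t
    proof (cases "t \<le> b")
      case True
      moreover have "b \<le> q" using q(1) unfolding isLub_UNIV_iff by blast
      ultimately show ?thesis by (rule order_trans)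
    next
      case False
      then show ?thesis using q(1) that unfolding isLub_UNIV_iff A_def by blast
    qed
    obtain j where j: "isLub UNIV T j" using bounded_imp_isLub[of T q] Tq by blast
    have "j \<notin> G"
    proof
      assume jG: "j \<in> G"
      have Tj: "t \<le> j" if "t \<in> T" for t using j that unfolding isLub_UNIV_iff by blast
      have "j \<le> q" using j Tq unfolding isLub_UNIV_iff by blast
      then obtain a where a: "a \<in> insert b A" "j \<le> a"
        using factors_above[of j "insert b G" q] jG q(2) by auto
      show False
      proof (cases "a = b")
        case True
        \<comment> \<open>Since \<open>j \<le> b\<close> and \<open>j\<close> is in
          \<open>G\<close>, it lies below some \<open>g\<close> in \<open>F\<close>. Then
          \<open>f \<le> j \<le> g\<close> forces \<open>f = g\<close>, so \<open>f\<close> is the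
          greatest element of \<open>T\<close>.\<close>
        then obtain g where g: "g \<in> F" "j \<le> g"
          using factors_above[OF jG, of b] a F_def by blast
        then have "f = g"
          using Tj[OF f(1)] f(2) antichainD[OF antichain_factors, of f G b g] unfolding F_def by auto
        then have "\<And>t. t \<in> T \<Longrightarrow> t \<le> f" using Tj g(2) order_trans by blast
        then show False using no_upper f(1) by blast
      next
        case False
        then have "a \<in> T" using a unfolding A_def by auto
        moreover have "\<And>t. t \<in> T \<Longrightarrow> t \<le> a" using Tj a(2) order_trans by blast
        ultimately show False using no_upper by blast
      qed
    qed
    then show ?thesis using j by blast
  qed
qed

text \<open>In an antichain \<open>T\<close> containing \<open>b\<close>, the element
  \<open>b\<close> is traded for factors of \<open>b\<close>. This yields an antichain inside
  \<open>S \<union> F\<close> with the same upper bounds, so its join, known to exist outside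
  \<open>G\<close>, is also the join of \<open>T\<close>. That join lies above an element not below
  \<open>b\<close>, hence differs from \<open>b\<close>.\<close>

lemma nested_complex_insert_b:
  assumes bS: "b \<notin> S" and FS: "\<not> F \<subseteq> S" and SF: "S \<union> F \<in> nested_complex G"
  shows "insert b S \<in> nested_complex (insert b G)"
proof (rule nested_complexI)
  have S: "S \<in> nested_complex (insert b G)"
    using nested_complex_insert_notin[OF bS] FS nested_complex_subset[OF SF] by auto
  then show "insert b S \<subseteq> insert b G" unfolding nested_complex_def by auto
  fix T assume T: "T \<subseteq> insert b S" "card T \<ge> 2" "antichain T"
  show "\<exists>j. isLub UNIV T j \<and> j \<notin> insert b G"
  proof (cases "b \<in> T")
    case False
    then have "T \<subseteq> S" using T by auto
    then show ?thesis using nested_complexD[OF S _ T(2,3)] by blast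
  next
    case True
    define A where "A = T - {b}"
    have AS: "A \<subseteq> S" using T(1) A_def by auto
    have inc: "\<not> a \<le> b" "\<not> b \<le> a" if "a \<in> A" for a
      using T(3) True that unfolding A_def pairwise_def by auto
    have "card A \<noteq> 0" using T(2) True unfolding A_def by (simp add: card_Diff_singleton)
    then obtain a where a: "a \<in> A" by fastforce
    \<comment> \<open>Factors lying below an element of \<open>A\<close> are left out: they would
      spoil the antichain property, and they impose no further condition on upper bounds.\<close>
    define M where "M = A \<union> {f \<in> F. \<forall>t\<in>A. \<not> f \<le> t}"
    have anti: "antichain M"
    proof -
      have "antichain A" "antichain F"
        using T(3) antichain_factors unfolding A_def F_def by (auto intro: pairwise_subset)
      moreover have "\<not> t \<le> f" if "t \<in> A" "f \<in> F" for t f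
        using inc(1)[OF that(1)] F_le[OF that(2)] order_trans by blast
      ultimately show ?thesis unfolding M_def pairwise_def by blast
    qed
    have ub: "(\<forall>t\<in>M. t \<le> u) \<longleftrightarrow> (\<forall>t\<in>T. t \<le> u)" for u
    proof
      assume u: "\<forall>t\<in>M. t \<le> u"
      then have "f \<le> u" if "f \<in> F" for f using that order_trans unfolding M_def by blast
      then have "b \<le> u" using F_lub unfolding isLub_UNIV_iff by blast
      then show "\<forall>t\<in>T. t \<le> u" using u unfolding M_def A_def by auto
    next
      assume u: "\<forall>t\<in>T. t \<le> u"
      then show "\<forall>t\<in>M. t \<le> u" using F_le True order_trans unfolding M_def A_def by blast
    qed
    \<comment> \<open>If \<open>M\<close> were \<open>{a}\<close>, then \<open>a\<close> would bound
      \<open>T\<close> as well and so lie above \<open>b\<close>.\<close>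
    have "card M \<ge> 2"
    proof (rule ccontr)
      assume "\<not> card M \<ge> 2"
      moreover have aM: "a \<in> M" using a unfolding M_def by auto
      ultimately have "card M = 1"
        by (metis One_nat_def card_0_eq empty_iff finite less_2_cases not_less)
      then have "M = {a}" using aM by (auto simp: card_1_singleton_iff)
      then have "\<forall>t\<in>T. t \<le> a" using ub[of a] by auto
      then show False using inc(2)[OF a] True by blast
    qed
    then obtain j where j: "isLub UNIV M j" "j \<notin> G"
      using nested_complexD[OF SF _ _ anti] AS unfolding M_def by blast
    have jT: "isLub UNIV T j" using j(1) ub unfolding isLub_UNIV_iff by blast
    then have "a \<le> j" using a unfolding isLub_UNIV_iff A_def by blast
    then have "j \<noteq> b" using inc(1)[OF a] by auto
    then show ?thesis using jT j(2) by blast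
  qed
qed

text \<open>The face description of a stellar subdivision: faces containing \<open>F\<close>
  disappear, and the new faces join the vertex \<open>b\<close> to proper parts of faces
  \<open>S \<union> F\<close>. This form splits the sum for the larger building set into two index
  sets that refer to \<open>G\<close> only.\<close>

lemma nested_complex_insert:
  "nested_complex (insert b G) = {S \<in> nested_complex G. \<not> F \<subseteq> S} \<union>
     insert b ` {S. \<not> F \<subseteq> S \<and> S \<union> F \<in> nested_complex G}" (is "?N = ?X \<union> insert b ` ?Y")
proof
  have nb: "b \<notin> S" if "S \<in> nested_complex G" for S
    using that bG unfolding nested_complex_def by auto
  show "?X \<union> insert b ` ?Y \<subseteq> ?N"
    using nb nested_complex_insert_notin nested_complex_insert_b by blast
  show "?N \<subseteq> ?X \<union> insert b ` ?Y"
  proof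
    fix S assume S: "S \<in> ?N"
    show "S \<in> ?X \<union> insert b ` ?Y"
    proof (cases "b \<in> S")
      case False
      then show ?thesis using S nested_complex_insert_notin by blast
    next
      case True
      let ?S = "S - {b}"
      have S': "insert b ?S = S" using True by auto
      have "\<not> F \<subseteq> ?S"
        using nested_complex_insert_notin[of ?S] nested_complex_subset[OF S, of ?S] by auto
      moreover have "?S \<union> F \<in> nested_complex G"
        using nested_complex_union_factors[of ?S] S S' by auto
      ultimately have "?S \<in> ?Y" by blast
      then have "insert b ?S \<in> insert b ` ?Y" by (rule imageI)
      then show ?thesis using S' by simp
    qed
  qed
qed

end

section \<open>Finite sums and integer multiples in abelian monoids and groups\<close>

context abelian_monoid
begin

lemma finsum_swap:
  assumes "finite A" "finite B" "\<And>x y. x \<in> A \<Longrightarrow> y \<in> B \<Longrightarrow> f x y \<in> carrier G"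
  shows "(\<Oplus>x\<in>A. \<Oplus>y\<in>B. f x y) = (\<Oplus>y\<in>B. \<Oplus>x\<in>A. f x y)"
  using assms(1,3)
proof (induction A rule: finite_induct)
  case (insert a A)
  then have "(\<Oplus>y\<in>B. \<Oplus>x\<in>insert a A. f x y) = (\<Oplus>y\<in>B. f a y \<oplus> (\<Oplus>x\<in>A. f x y))"
    by (intro finsum_cong') auto
  also have "\<dots> = (\<Oplus>y\<in>B. f a y) \<oplus> (\<Oplus>y\<in>B. \<Oplus>x\<in>A. f x y)"
    using insert.prems by (intro finsum_addf) auto
  finally show ?case using insert by auto
qed simp

text \<open>The induction step for sums over power sets: subsets are sorted by whether they contain
  \<open>a\<close>.\<close>

lemma finsum_Pow_insert:
  assumes "finite F" "a \<notin> F" "\<And>P. P \<subseteq> insert a F \<Longrightarrow> f P \<in> carrier G"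
  shows "(\<Oplus>P\<in>Pow (insert a F). f P) = (\<Oplus>P\<in>Pow F. f P) \<oplus> (\<Oplus>P\<in>Pow F. f (insert a P))"
proof -
  have "f (insert a P) \<in> carrier G" if "P \<in> Pow F" for P
    using assms(3)[of "insert a P"] that by blast
  moreover have "inj_on (insert a) (Pow F)" using assms(2) by (auto simp: inj_on_def)
  ultimately have "(\<Oplus>P\<in>insert a ` Pow F. f P) = (\<Oplus>P\<in>Pow F. f (insert a P))"
    by (intro finsum_reindex) auto
  moreover have "(\<Oplus>P\<in>Pow F \<union> insert a ` Pow F. f P)
      = (\<Oplus>P\<in>Pow F. f P) \<oplus> (\<Oplus>P\<in>insert a ` Pow F. f P)"
    using assms(1,2) by (intro finsum_Un_disjoint funcsetI assms(3)) auto
  ultimately show ?thesis unfolding Pow_insert by simp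
qed

end

context abelian_group
begin

lemma add_pow_int_0: "[(0::int)] \<cdot> x = \<zero>"
  by (simp add: add_pow_int_ge add.nat_pow_0)

lemma finsum_int_scale:
  assumes "finite A" "\<And>x. x \<in> A \<Longrightarrow> f x \<in> carrier G"
  shows "[(k::int)] \<cdot> (\<Oplus>x\<in>A. f x) = (\<Oplus>x\<in>A. [k] \<cdot> f x)"
  using assms by (induction A rule: finite_induct) (auto simp: Pi_def add.int_pow_distrib)

text \<open>It serves to expand the integer sum \<open>chi_circ\<close> when it occurs as a
  coefficient.\<close>

lemma sum_int_scale:
  assumes "finite A" "x \<in> carrier G"
  shows "[(\<Sum>a\<in>A. k a :: int)] \<cdot> x = (\<Oplus>a\<in>A. [k a] \<cdot> x)"
  using assms by (induction A rule: finite_induct) (auto simp: Pi_def add.int_pow_mult add_pow_int_0)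

end

section \<open>Subset expansions of products in a commutative ring\<close>

context cring
begin

text \<open>By induction on \<open>F\<close>: a new index \<open>x\<close> contributes the factor
  \<open>a x\<close> to subsets containing it and \<open>b x\<close> to the others. The constant
  cases \<open>b i = \<ominus> \<one>\<close> and \<open>b i = \<one>\<close> are the ones applied
  later.\<close>

lemma finprod_add_expand:
  assumes "finite F" "a \<in> F \<rightarrow> carrier R" "b \<in> F \<rightarrow> carrier R"
  shows "(\<Otimes>i\<in>F. a i \<oplus> b i) = (\<Oplus>P\<in>Pow F. (\<Otimes>i\<in>P. a i) \<otimes> (\<Otimes>i\<in>F - P. b i))"
  using assms
proof (induction F rule: finite_induct)
  case (insert x F)
  let ?f = "\<lambda>F P. (\<Otimes>i\<in>P. a i) \<otimes> (\<Otimes>i\<in>F - P. b i)"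
  have cl: "?f F' P \<in> carrier R" if "P \<subseteq> insert x F" "F' \<subseteq> insert x F" for F' P
    using that insert.prems by (intro m_closed finprod_closed) auto
  have clF: "?f F P \<in> carrier R" if "P \<subseteq> F" for P
    using cl[of P F] that by blast
  have x: "a x \<in> carrier R" "b x \<in> carrier R" using insert.prems by auto
  have ins: "(\<Otimes>i\<in>insert x P. c i) = c x \<otimes> (\<Otimes>i\<in>P. c i)"
    if "P \<subseteq> F" "c \<in> insert x F \<rightarrow> carrier R" for P c
    using that insert.hyps finite_subset by (intro finprod_insert) auto
  have 1: "?f (insert x F) P = b x \<otimes> ?f F P" if "P \<subseteq> F" for P
  proof -
    have "insert x F - P = insert x (F - P)" using that insert.hyps by auto
    moreover have "(\<Otimes>i\<in>P. a i) \<in> carrier R" "(\<Otimes>i\<in>F - P. b i) \<in> carrier R"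
      using that insert.prems by (intro finprod_closed; auto)+
    ultimately show ?thesis using ins[of "F - P" b] insert.prems x by (simp add: m_lcomm)
  qed
  have 2: "?f (insert x F) (insert x P) = a x \<otimes> ?f F P" if "P \<subseteq> F" for P
  proof -
    have "insert x F - insert x P = F - P" using that insert.hyps by auto
    moreover have "(\<Otimes>i\<in>P. a i) \<in> carrier R" "(\<Otimes>i\<in>F - P. b i) \<in> carrier R"
      using that insert.prems by (intro finprod_closed; auto)+
    ultimately show ?thesis using ins[OF that, of a] insert.prems x by (simp add: m_assoc)
  qed
  have "(\<Oplus>P\<in>Pow (insert x F). ?f (insert x F) P)
      = (\<Oplus>P\<in>Pow F. ?f (insert x F) P) \<oplus> (\<Oplus>P\<in>Pow F. ?f (insert x F) (insert x P))"
    using insert.hyps cl by (intro finsum_Pow_insert) auto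
  also have "\<dots> = (\<Oplus>P\<in>Pow F. b x \<otimes> ?f F P) \<oplus> (\<Oplus>P\<in>Pow F. a x \<otimes> ?f F P)"
    using 1 2 clF x by (intro arg_cong2[of _ _ _ _ "(\<oplus>)"] finsum_cong') auto
  also have "\<dots> = b x \<otimes> (\<Oplus>P\<in>Pow F. ?f F P) \<oplus> a x \<otimes> (\<Oplus>P\<in>Pow F. ?f F P)"
    using clF x insert.hyps by (simp add: finsum_rdistr Pi_def)
  also have "\<dots> = (a x \<oplus> b x) \<otimes> (\<Otimes>i\<in>F. a i \<oplus> b i)"
    using clF x insert by (simp add: l_distr a_comm Pi_def)
  also have "\<dots> = (\<Otimes>i\<in>insert x F. a i \<oplus> b i)"
    using insert x by (subst finprod_insert) auto
  finally show ?case by simp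
qed simp

lemma finprod_minus_one:
  assumes "finite F"
  shows "(\<Otimes>i\<in>F. \<ominus> \<one>) = [((- 1 :: int) ^ card F)] \<cdot> \<one>"
  using assms
proof (induction F rule: finite_induct)
  case (insert x F)
  have "[(- k :: int)] \<cdot> \<one> = \<ominus> ([k] \<cdot> \<one>)" for k by (rule add.int_pow_neg) simp
  then show ?case using insert by (simp add: l_minus)
qed (simp add: add.int_pow_1)

text \<open>The signs are written as integer multiples so as to match the coefficients in
  \<open>chi_circ\<close>.\<close>

lemma finprod_minus_one_expand:
  assumes "finite F" "c \<in> F \<rightarrow> carrier R"
  shows "(\<Otimes>i\<in>F. c i \<ominus> \<one>) = (\<Oplus>P\<in>Pow F. [((- 1 :: int) ^ (card F - card P))] \<cdot> (\<Otimes>i\<in>P. c i))"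
proof -
  have "(\<Otimes>i\<in>F. c i \<oplus> \<ominus> \<one>) = (\<Oplus>P\<in>Pow F. (\<Otimes>i\<in>P. c i) \<otimes> (\<Otimes>i\<in>F - P. \<ominus> \<one>))"
    using assms by (intro finprod_add_expand) auto
  also have "\<dots> = (\<Oplus>P\<in>Pow F. [((- 1 :: int) ^ (card F - card P))] \<cdot> (\<Otimes>i\<in>P. c i))"
  proof (intro finsum_cong' refl)
    fix P assume P: "P \<in> Pow F"
    then have "finite P" "(\<Otimes>i\<in>P. c i) \<in> carrier R"
      using assms finite_subset by (auto intro!: finprod_closed)
    then show "(\<Otimes>i\<in>P. c i) \<otimes> (\<Otimes>i\<in>F - P. \<ominus> \<one>) = [((- 1 :: int) ^ (card F - card P))] \<cdot> (\<Otimes>i\<in>P. c i)"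
      using P assms by (simp add: finprod_minus_one add_pow_rdistr_int card_Diff_subset)
  qed (use assms in \<open>auto intro!: add.int_pow_closed finprod_closed\<close>)
  finally show ?thesis by (simp add: a_minus_def)
qed

text \<open>Each \<open>c i\<close> is expanded as
  \<open>(c i \<ominus> \<one>) \<oplus> \<one>\<close>; choosing the second summand contributes
  only factors \<open>\<one>\<close>.\<close>

lemma finprod_expand_of_minus_one:
  assumes "finite F" "c \<in> F \<rightarrow> carrier R"
  shows "(\<Oplus>P\<in>Pow F. \<Otimes>i\<in>P. c i \<ominus> \<one>) = (\<Otimes>i\<in>F. c i)"
proof -
  have "(\<Otimes>i\<in>F. (c i \<ominus> \<one>) \<oplus> \<one>) = (\<Oplus>P\<in>Pow F. (\<Otimes>i\<in>P. c i \<ominus> \<one>) \<otimes> (\<Otimes>i\<in>F - P. \<one>))"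
    using assms by (intro finprod_add_expand) auto
  also have "\<dots> = (\<Oplus>P\<in>Pow F. \<Otimes>i\<in>P. c i \<ominus> \<one>)"
  proof (intro finsum_cong' refl)
    fix P assume "P \<in> Pow F"
    then have "(\<Otimes>i\<in>P. c i \<ominus> \<one>) \<in> carrier R" using assms by (intro finprod_closed) auto
    then show "(\<Otimes>i\<in>P. c i \<ominus> \<one>) \<otimes> (\<Otimes>i\<in>F - P. \<one>) = (\<Otimes>i\<in>P. c i \<ominus> \<one>)" by simp
  qed (use assms in \<open>auto intro!: finprod_closed\<close>)
  moreover have "(\<Otimes>i\<in>F. (c i \<ominus> \<one>) \<oplus> \<one>) = (\<Otimes>i\<in>F. c i)"
  proof (intro finprod_cong' refl)
    fix i assume "i \<in> F"
    then have "c i \<in> carrier R" using assms by auto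
    then show "(c i \<ominus> \<one>) \<oplus> \<one> = c i" by algebra
  qed (use assms in auto)
  ultimately show ?thesis by simp
qed

text \<open>Counting pairs of a subset \<open>P\<close> and an \<open>i\<close> in
  \<open>F - P\<close> explains the value: the subsets avoiding \<open>i\<close> sum to the product
  of the inverses over \<open>F - {i}\<close>, which is \<open>\<alpha> i\<close> times the full
  product. The proof is an induction instead, in which a new index \<open>x\<close> turns the sum
  \<open>?L\<close> into \<open>(?L \<oplus> ?S) \<oplus> w x \<otimes> ?L\<close>, where
  \<open>?S\<close> is the sum without cardinalities.\<close>

lemma finsum_card_Diff:
  assumes "finite F" "\<alpha> \<in> F \<rightarrow> Units R"
  shows "(\<Oplus>P\<in>Pow F. [int (card (F - P))] \<cdot> (\<Otimes>i\<in>P. inv \<alpha> i \<ominus> \<one>))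
    = (\<Oplus>i\<in>F. \<alpha> i) \<otimes> (\<Otimes>i\<in>F. inv \<alpha> i)"
  using assms
proof (induction F rule: finite_induct)
  case empty
  then show ?case by (simp add: add_pow_int_0)
next
  case (insert x F)
  define w where "w i = inv \<alpha> i \<ominus> \<one>" for i
  have w: "w i \<in> carrier R" if "i \<in> insert x F" for i
    using insert.prems that unfolding w_def by auto
  have pw: "(\<Otimes>i\<in>P. w i) \<in> carrier R" if "P \<subseteq> insert x F" for P
    using w that by (intro finprod_closed) auto
  let ?L = "\<Oplus>P\<in>Pow F. [int (card (F - P))] \<cdot> (\<Otimes>i\<in>P. w i)"
  let ?S = "\<Oplus>P\<in>Pow F. \<Otimes>i\<in>P. w i"
  have L: "?L \<in> carrier R" "?S \<in> carrier R" using pw by (auto intro!: finsum_closed add.int_pow_closed)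
  have x: "\<alpha> x \<in> carrier R" "inv \<alpha> x \<in> carrier R" "\<alpha> x \<otimes> inv \<alpha> x = \<one>"
    "(\<Oplus>i\<in>F. \<alpha> i) \<in> carrier R" "(\<Otimes>i\<in>F. inv \<alpha> i) \<in> carrier R"
    using insert.prems by (auto intro!: finsum_closed finprod_closed)
  \<comment> \<open>The relation \<open>a \<otimes> u = \<one>\<close> is substituted by hand; what
    remains are polynomial identities.\<close>
  have step: "s \<otimes> q \<oplus> q \<oplus> (u \<ominus> \<one>) \<otimes> (s \<otimes> q) = (a \<oplus> s) \<otimes> (u \<otimes> q)"
    if "a \<in> carrier R" "u \<in> carrier R" "a \<otimes> u = \<one>" "s \<in> carrier R" "q \<in> carrier R" for a s u q
  proof -
    have "(a \<oplus> s) \<otimes> (u \<otimes> q) = (a \<otimes> u) \<otimes> q \<oplus> (s \<otimes> u) \<otimes> q"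
      using that(1,2,4,5) by algebra
    also have "\<dots> = s \<otimes> q \<oplus> q \<oplus> (u \<ominus> \<one>) \<otimes> (s \<otimes> q)"
      unfolding that(3) using that(2,4,5) by algebra
    finally show ?thesis by simp
  qed
  have 1: "[int (card (insert x F - P))] \<cdot> (\<Otimes>i\<in>P. w i)
      = [int (card (F - P))] \<cdot> (\<Otimes>i\<in>P. w i) \<oplus> (\<Otimes>i\<in>P. w i)" if "P \<subseteq> F" for P
  proof -
    have "insert x F - P = insert x (F - P)" using that insert.hyps by auto
    then have "int (card (insert x F - P)) = int (card (F - P)) + 1" using insert.hyps by simp
    then show ?thesis using pw[of P] that by (simp add: add.int_pow_mult subset_insertI2)
  qed
  have 2: "[int (card (insert x F - insert x P))] \<cdot> (\<Otimes>i\<in>insert x P. w i)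
      = w x \<otimes> [int (card (F - P))] \<cdot> (\<Otimes>i\<in>P. w i)" if "P \<subseteq> F" for P
  proof -
    have "insert x F - insert x P = F - P" using that insert.hyps by auto
    moreover have "(\<Otimes>i\<in>insert x P. w i) = w x \<otimes> (\<Otimes>i\<in>P. w i)"
      using that insert.hyps w finite_subset by (intro finprod_insert) auto
    ultimately show ?thesis using that w pw[of P] by (simp add: add_pow_rdistr_int subset_insertI2)
  qed
  have "(\<Oplus>P\<in>Pow (insert x F). [int (card (insert x F - P))] \<cdot> (\<Otimes>i\<in>P. w i))
      = (\<Oplus>P\<in>Pow F. [int (card (insert x F - P))] \<cdot> (\<Otimes>i\<in>P. w i)) \<oplus>
        (\<Oplus>P\<in>Pow F. [int (card (insert x F - insert x P))] \<cdot> (\<Otimes>i\<in>insert x P. w i))"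
    using insert.hyps pw by (intro finsum_Pow_insert) auto
  also have "\<dots> = (\<Oplus>P\<in>Pow F. [int (card (F - P))] \<cdot> (\<Otimes>i\<in>P. w i) \<oplus> (\<Otimes>i\<in>P. w i)) \<oplus>
        (\<Oplus>P\<in>Pow F. w x \<otimes> [int (card (F - P))] \<cdot> (\<Otimes>i\<in>P. w i))"
    using 1 2 pw w by (intro arg_cong2[of _ _ _ _ "(\<oplus>)"] finsum_cong') (auto simp: subset_insertI2)
  also have "\<dots> = (?L \<oplus> ?S) \<oplus> w x \<otimes> ?L"
    using pw w insert.hyps by (simp add: finsum_addf finsum_rdistr Pi_def subset_insertI2)
  also have "?S = (\<Otimes>i\<in>F. inv \<alpha> i)"
    unfolding w_def using insert by (intro finprod_expand_of_minus_one) auto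
  also have "?L = (\<Oplus>i\<in>F. \<alpha> i) \<otimes> (\<Otimes>i\<in>F. inv \<alpha> i)"
    unfolding w_def using insert by auto
  also have "(\<Oplus>i\<in>F. \<alpha> i) \<otimes> (\<Otimes>i\<in>F. inv \<alpha> i) \<oplus> (\<Otimes>i\<in>F. inv \<alpha> i) \<oplus>
      w x \<otimes> ((\<Oplus>i\<in>F. \<alpha> i) \<otimes> (\<Otimes>i\<in>F. inv \<alpha> i))
      = (\<alpha> x \<oplus> (\<Oplus>i\<in>F. \<alpha> i)) \<otimes> (inv \<alpha> x \<otimes> (\<Otimes>i\<in>F. inv \<alpha> i))"
    unfolding w_def by (rule step[OF x])
  also have "\<alpha> x \<oplus> (\<Oplus>i\<in>F. \<alpha> i) = (\<Oplus>i\<in>insert x F. \<alpha> i)"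
    using insert x by (subst finsum_insert) auto
  also have "inv \<alpha> x \<otimes> (\<Otimes>i\<in>F. inv \<alpha> i) = (\<Otimes>i\<in>insert x F. inv \<alpha> i)"
    using insert x by (subst finprod_insert) auto
  finally show ?case unfolding w_def .
qed

section \<open>The weight identity for the new vertex\<close>

text \<open>The omitted term \<open>P = F\<close> has cardinality 0 and equals minus
  \<open>w F\<close>, so the claim says that the sum over all subsets vanishes. Each term regroups
  as \<open>inv \<beta>\<close> times \<open>card (F - P)\<close> copies of \<open>w P\<close>,
  minus \<open>w P\<close>. The two resulting sums are
  \<open>inv \<beta> \<otimes> \<beta> \<otimes> ?q\<close> and \<open>?q\<close>, which cancel;
  this is where the choice of \<open>\<beta>\<close> as the sum of the \<open>\<alpha> i\<close>
  enters.\<close>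

lemma blowup_weight_identity:
  assumes "finite F" and \<alpha>: "\<alpha> \<in> F \<rightarrow> Units R"
    and \<beta>: "\<beta> \<in> Units R" "\<beta> = (\<Oplus>i\<in>F. \<alpha> i)"
  defines "w \<equiv> \<lambda>P. \<Otimes>i\<in>P. inv \<alpha> i \<ominus> \<one>"
  shows "(\<Oplus>P\<in>Pow F - {F}. [(int (card (F - P)) - 1)] \<cdot> w P \<oplus>
      [int (card (F - P))] \<cdot> ((inv \<beta> \<ominus> \<one>) \<otimes> w P)) = w F"
    (is "(\<Oplus>P\<in>_. ?h P) = _")
proof -
  have w: "w P \<in> carrier R" if "P \<subseteq> F" for P
    using \<alpha> that unfolding w_def by (intro finprod_closed) auto
  have c: "inv \<beta> \<in> carrier R" "inv \<beta> \<ominus> \<one> \<in> carrier R" using \<beta> by auto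
  have h: "?h P \<in> carrier R" if "P \<subseteq> F" for P
    using w[OF that] c by simp
  let ?L = "\<Oplus>P\<in>Pow F. [int (card (F - P))] \<cdot> w P"
  let ?q = "\<Otimes>i\<in>F. inv \<alpha> i"
  have q: "?q \<in> carrier R" using \<alpha> by (auto intro!: finprod_closed)
  have L: "?L = \<beta> \<otimes> ?q" unfolding w_def \<beta>(2) by (rule finsum_card_Diff[OF assms(1,2)])
  have S: "(\<Oplus>P\<in>Pow F. w P) = ?q"
    unfolding w_def using assms by (intro finprod_expand_of_minus_one) auto
  have "?h P = inv \<beta> \<otimes> [int (card (F - P))] \<cdot> w P \<oplus> (\<ominus> \<one>) \<otimes> w P" if "P \<subseteq> F" for P
  proof -
    have v: "[int (card (F - P))] \<cdot> w P \<in> carrier R" using w[OF that] by simp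
    have "[(int (card (F - P)) - 1)] \<cdot> w P = [int (card (F - P))] \<cdot> w P \<ominus> w P"
      using add.int_pow_diff[OF w[OF that]] w[OF that] by (simp add: a_minus_def)
    moreover have "[int (card (F - P))] \<cdot> ((inv \<beta> \<ominus> \<one>) \<otimes> w P)
        = (inv \<beta> \<ominus> \<one>) \<otimes> [int (card (F - P))] \<cdot> w P"
      using w[OF that] c by (simp add: add_pow_rdistr_int)
    ultimately show ?thesis using v w[OF that] c(1) by algebra
  qed
  then have "(\<Oplus>P\<in>Pow F. ?h P) = (\<Oplus>P\<in>Pow F. inv \<beta> \<otimes> [int (card (F - P))] \<cdot> w P \<oplus> (\<ominus> \<one>) \<otimes> w P)"
    using w c by (intro finsum_cong') auto
  also have "\<dots> = inv \<beta> \<otimes> ?L \<oplus> (\<ominus> \<one>) \<otimes> (\<Oplus>P\<in>Pow F. w P)"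
    using w c assms(1) by (simp add: finsum_addf finsum_rdistr Pi_def)
  also have "\<dots> = (inv \<beta> \<otimes> \<beta>) \<otimes> ?q \<oplus> (\<ominus> \<one>) \<otimes> ?q"
    unfolding L S using Units_closed[OF \<beta>(1)] c q by (simp only: m_assoc)
  also have "\<dots> = \<zero>" using \<beta>(1) q by (simp add: l_minus r_neg)
  finally have sum: "(\<Oplus>P\<in>Pow F. ?h P) = \<zero>" .
  have "Pow F = insert F (Pow F - {F})" by auto
  then have "(\<Oplus>P\<in>Pow F. ?h P) = (\<Oplus>P\<in>insert F (Pow F - {F}). ?h P)" by simp
  also have "\<dots> = ?h F \<oplus> (\<Oplus>P\<in>Pow F - {F}. ?h P)"
    using assms(1) by (intro finsum_insert funcsetI h) auto
  also have "?h F = \<ominus> w F"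
    using w[of F] c add.int_pow_neg[of "w F" 1] by (simp add: add_pow_int_0)
  finally have "\<ominus> w F \<oplus> (\<Oplus>P\<in>Pow F - {F}. ?h P) = \<zero>" using sum by simp
  moreover have "(\<Oplus>P\<in>Pow F - {F}. ?h P) \<in> carrier R" using h by (intro finsum_closed) auto
  ultimately show ?thesis using w[of F] r_neg2[of "w F" "\<Oplus>P\<in>Pow F - {F}. ?h P"] by simp
qed

section \<open>The function Z as a sum over the values of \<chi>\<close>

text \<open>After exchanging the sums, the inner one runs over all subsets of \<open>T\<close>,
  because these are nested again. It is then the alternating expansion of a product.\<close>

lemma Z_fun_expand:
  fixes G :: "'c::{finite, order} set"
  assumes \<alpha>: "\<alpha> \<in> G \<rightarrow> Units R"
  shows "Z_fun R G \<chi> \<alpha> = (\<Oplus>T\<in>nested_complex G. [\<chi> T] \<cdot> (\<Otimes>A\<in>T. inv \<alpha> A \<ominus> \<one>))"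
proof -
  let ?N = "nested_complex G"
  let ?m = "\<lambda>U. \<Otimes>A\<in>U. inv \<alpha> A"
  let ?s = "\<lambda>T U. (- 1 :: int) ^ (card T - card U)"
  \<comment> \<open>Extending the terms by zero lets both indices range over the whole complex, so
    that the sums can be exchanged.\<close>
  let ?g = "\<lambda>U T. if U \<subseteq> T then [(?s T U * \<chi> T)] \<cdot> ?m U else \<zero>"
  have sub: "U \<subseteq> G" if "U \<in> ?N" for U using that unfolding nested_complex_def by auto
  have m: "?m U \<in> carrier R" if "U \<subseteq> G" for U
    using \<alpha> that by (intro finprod_closed) auto
  have g: "?g U T \<in> carrier R" if "U \<in> ?N" for U T using m[OF sub[OF that]] by simp
  have "Z_fun R G \<chi> \<alpha> = (\<Oplus>U\<in>?N. \<Oplus>T\<in>?N. ?g U T)"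
    unfolding Z_fun_def
  proof (intro finsum_cong' refl funcsetI finsum_closed g)
    fix U assume U: "U \<in> ?N"
    have "[chi_circ G \<chi> U] \<cdot> ?m U = (\<Oplus>T\<in>{T \<in> ?N. U \<subseteq> T}. [(?s T U * \<chi> T)] \<cdot> ?m U)"
      unfolding chi_circ_def using m[OF sub[OF U]] by (intro sum_int_scale) auto
    also have "\<dots> = (\<Oplus>T\<in>?N. ?g U T)"
      using g[OF U] by (intro add.finprod_mono_neutral_cong_left) auto
    finally show "[chi_circ G \<chi> U] \<cdot> ?m U = (\<Oplus>T\<in>?N. ?g U T)" .
  qed
  also have "\<dots> = (\<Oplus>T\<in>?N. \<Oplus>U\<in>?N. ?g U T)"
    by (intro finsum_swap finite g)
  also have "\<dots> = (\<Oplus>T\<in>?N. [\<chi> T] \<cdot> (\<Otimes>A\<in>T. inv \<alpha> A \<ominus> \<one>))"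
  proof (intro finsum_cong' refl funcsetI)
    fix T assume T: "T \<in> ?N"
    have \<alpha>T: "(\<lambda>A. inv \<alpha> A) \<in> T \<rightarrow> carrier R" using \<alpha> sub[OF T] by auto
    have mT: "?m U \<in> carrier R" if "U \<in> Pow T" for U using m[of U] sub[OF T] that by blast
    have PN: "Pow T \<subseteq> ?N" using nested_complex_subset[OF T] by auto
    show "[\<chi> T] \<cdot> (\<Otimes>A\<in>T. inv \<alpha> A \<ominus> \<one>) \<in> carrier R"
      using \<alpha>T by (intro add.int_pow_closed finprod_closed) auto
    have "(\<Oplus>U\<in>?N. ?g U T) = (\<Oplus>U\<in>Pow T. [(?s T U * \<chi> T)] \<cdot> ?m U)"
      using PN g by (intro add.finprod_mono_neutral_cong_right) auto
    also have "\<dots> = (\<Oplus>U\<in>Pow T. [\<chi> T] \<cdot> ([(?s T U)] \<cdot> ?m U))"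
      using mT by (intro finsum_cong') (auto simp: add.int_pow_pow)
    also have "\<dots> = [\<chi> T] \<cdot> (\<Oplus>U\<in>Pow T. [(?s T U)] \<cdot> ?m U)"
      using mT by (intro finsum_int_scale[symmetric]) auto
    also have "\<dots> = [\<chi> T] \<cdot> (\<Otimes>A\<in>T. inv \<alpha> A \<ominus> \<one>)"
      using \<alpha>T by (subst finprod_minus_one_expand) auto
    finally show "(\<Oplus>U\<in>?N. ?g U T) = [\<chi> T] \<cdot> (\<Otimes>A\<in>T. inv \<alpha> A \<ominus> \<one>)" .
  qed
  finally show ?thesis .
qed

end

section \<open>Comparison of the two sums\<close>

theorem theorem2:
  fixes G\<^sub>1 G\<^sub>2 :: "'a::{finite, semilattice_inf, order_bot} set"
    and b :: 'a
    and R :: "('r, 'm) ring_scheme"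
    and \<chi> :: "'a set \<Rightarrow> int"
    and \<alpha> :: "'a \<Rightarrow> 'r"
  assumes "building_set G\<^sub>1"
    and "b \<notin> G\<^sub>1"
    and "G\<^sub>2 = G\<^sub>1 \<union> {b}"
    and "building_set G\<^sub>2"
    and "cring R"
    and "\<alpha> \<in> G\<^sub>2 \<rightarrow> Units R"
    and "\<alpha> b = (\<Oplus>\<^bsub>R\<^esub>A\<in>factors G\<^sub>1 b. \<alpha> A)"
  shows "Z_fun R G\<^sub>1 \<chi> \<alpha> = Z_fun R G\<^sub>2 (Bl G\<^sub>1 b \<chi>) \<alpha>"
proof -
  interpret cring R by fact
  define F where "F = factors G\<^sub>1 b"
  define w where "w U = (\<Otimes>\<^bsub>R\<^esub>A\<in>U. inv\<^bsub>R\<^esub> (\<alpha> A) \<ominus>\<^bsub>R\<^esub> \<one>\<^bsub>R\<^esub>)" for U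
  define wb where "wb = inv\<^bsub>R\<^esub> (\<alpha> b) \<ominus>\<^bsub>R\<^esub> \<one>\<^bsub>R\<^esub>"
  define N where "N = nested_complex G\<^sub>1"
  define X where "X = {S \<in> N. \<not> F \<subseteq> S}"
  define Y where "Y = {S. \<not> F \<subseteq> S \<and> S \<union> F \<in> N}"
  define k where "k S = int (card (F - S))" for S
  \<comment> \<open>\<open>h S\<close> collects the coefficient of
    \<open>\<chi> (S \<union> F)\<close> that the blow-up creates at \<open>S\<close> and at
    \<open>insert b S\<close> together.\<close>
  define h where "h S = [(k S - 1)] \<cdot>\<^bsub>R\<^esub> w S \<oplus>\<^bsub>R\<^esub> [k S] \<cdot>\<^bsub>R\<^esub> (wb \<otimes>\<^bsub>R\<^esub> w S)" for S
  let ?B = "Bl G\<^sub>1 b \<chi>"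
  have G2: "G\<^sub>2 = insert b G\<^sub>1" using assms(3) by simp
  have FG: "F \<subseteq> G\<^sub>1" unfolding F_def using factorsD by blast
  have NG: "S \<subseteq> G\<^sub>1" if "S \<in> N" for S using that unfolding N_def nested_complex_def by auto
  have YX: "Y \<subseteq> X"
    unfolding X_def Y_def N_def using nested_complex_subset by blast
  have XN: "S \<in> N" if "S \<in> X" for S using that unfolding X_def by blast
  have N2: "nested_complex G\<^sub>2 = X \<union> insert b ` Y"
    using nested_complex_insert[OF assms(1,2)] assms(4) unfolding G2 X_def Y_def N_def F_def by simp
  have wc: "inv\<^bsub>R\<^esub> (\<alpha> A) \<ominus>\<^bsub>R\<^esub> \<one>\<^bsub>R\<^esub> \<in> carrier R" if "A \<in> G\<^sub>2" for A
    using assms(6) that by auto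
  have wb: "wb \<in> carrier R" unfolding wb_def using wc G2 by blast
  have w: "w S \<in> carrier R" if "S \<subseteq> G\<^sub>1" for S
    unfolding w_def using wc that G2 by (intro finprod_closed) blast
  have wN: "w S \<in> carrier R" if "S \<in> N" for S using w[OF NG[OF that]] .
  have h: "h S \<in> carrier R" if "S \<subseteq> G\<^sub>1" for S
    unfolding h_def using w[OF that] wb by simp
  have w_insert: "w (insert b S) = wb \<otimes>\<^bsub>R\<^esub> w S" if "S \<subseteq> G\<^sub>1" for S
    unfolding w_def wb_def using that assms(2) wc G2 by (intro finprod_insert) auto
  have w_Un: "w (S \<union> P) = w S \<otimes>\<^bsub>R\<^esub> w P" if "S \<subseteq> G\<^sub>1" "P \<subseteq> G\<^sub>1" "S \<inter> P = {}" for S P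
    unfolding w_def using that wc G2 by (intro finprod_Un_disjoint) auto
  have bX: "b \<notin> S" if "S \<in> X" for S using that NG XN assms(2) by blast

  \<comment> \<open>As \<open>F\<close> is not contained in \<open>S\<close>, membership in
    \<open>Y\<close> amounts to \<open>S \<union> F\<close> being nested.\<close>
  have B_X: "?B S = \<chi> S + (if S \<in> Y then \<chi> (S \<union> F) * (k S - 1) else 0)" if "S \<in> X" for S
    using that bX[OF that] unfolding Bl_def Let_def X_def Y_def N_def F_def k_def by simp
  have B_Y: "?B (insert b S) = \<chi> (S \<union> F) * k S" if "S \<in> Y" for S
  proof -
    have "b \<notin> S" "b \<notin> F" using bX YX that FG assms(2) by blast+
    then have "insert b S - {b} \<union> F = S \<union> F" "F - insert b S = F - S" by auto
    then show ?thesis unfolding Bl_def Let_def k_def F_def by simp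
  qed

  have Z1: "Z_fun R G\<^sub>1 \<chi> \<alpha> = (\<Oplus>\<^bsub>R\<^esub>T\<in>N. [\<chi> T] \<cdot>\<^bsub>R\<^esub> w T)"
    using Z_fun_expand[of \<alpha> G\<^sub>1 \<chi>] assms(6) unfolding N_def w_def G2 by auto
  \<comment> \<open>The terms over \<open>X\<close> reappear unchanged on the other side, so only
    the nested sets containing \<open>F\<close> remain to be accounted for.\<close>
  have "N = X \<union> {T \<in> N. F \<subseteq> T}" unfolding X_def by auto
  then have "(\<Oplus>\<^bsub>R\<^esub>T\<in>N. [\<chi> T] \<cdot>\<^bsub>R\<^esub> w T) = (\<Oplus>\<^bsub>R\<^esub>T\<in>X \<union> {T \<in> N. F \<subseteq> T}. [\<chi> T] \<cdot>\<^bsub>R\<^esub> w T)"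
    by simp
  also have "\<dots> = (\<Oplus>\<^bsub>R\<^esub>T\<in>X. [\<chi> T] \<cdot>\<^bsub>R\<^esub> w T) \<oplus>\<^bsub>R\<^esub> (\<Oplus>\<^bsub>R\<^esub>T\<in>{T \<in> N. F \<subseteq> T}. [\<chi> T] \<cdot>\<^bsub>R\<^esub> w T)"
    using wN unfolding X_def by (intro finsum_Un_disjoint) auto
  finally have Z1': "Z_fun R G\<^sub>1 \<chi> \<alpha> =
      (\<Oplus>\<^bsub>R\<^esub>T\<in>X. [\<chi> T] \<cdot>\<^bsub>R\<^esub> w T) \<oplus>\<^bsub>R\<^esub> (\<Oplus>\<^bsub>R\<^esub>T\<in>{T \<in> N. F \<subseteq> T}. [\<chi> T] \<cdot>\<^bsub>R\<^esub> w T)"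
    unfolding Z1 .

  have wX: "w S \<in> carrier R" if "S \<in> X" for S using wN[OF XN[OF that]] .
  have wY: "w S \<in> carrier R" if "S \<in> Y" for S using wX YX that by blast
  have YG: "S \<subseteq> G\<^sub>1" if "S \<in> Y" for S using NG XN YX that by blast
  have w_insert_Y: "w (insert b S) \<in> carrier R" if "S \<in> Y" for S
    using w_insert[OF YG[OF that]] wY[OF that] wb by simp
  have "Z_fun R G\<^sub>2 ?B \<alpha> = (\<Oplus>\<^bsub>R\<^esub>S\<in>X \<union> insert b ` Y. [?B S] \<cdot>\<^bsub>R\<^esub> w S)"
    using Z_fun_expand[OF assms(6)] unfolding N2 w_def .
  also have "\<dots> = (\<Oplus>\<^bsub>R\<^esub>S\<in>X. [?B S] \<cdot>\<^bsub>R\<^esub> w S) \<oplus>\<^bsub>R\<^esub> (\<Oplus>\<^bsub>R\<^esub>S\<in>insert b ` Y. [?B S] \<cdot>\<^bsub>R\<^esub> w S)"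
    using wX w_insert_Y bX by (intro finsum_Un_disjoint) auto
  also have "(\<Oplus>\<^bsub>R\<^esub>S\<in>insert b ` Y. [?B S] \<cdot>\<^bsub>R\<^esub> w S) = (\<Oplus>\<^bsub>R\<^esub>S\<in>Y. [?B (insert b S)] \<cdot>\<^bsub>R\<^esub> w (insert b S))"
  proof (intro finsum_reindex)
    show "inj_on (insert b) Y" using bX YX by (intro inj_onI) (metis insert_ident subsetD)
  qed (use w_insert_Y in auto)
  also have "\<dots> = (\<Oplus>\<^bsub>R\<^esub>S\<in>Y. [(\<chi> (S \<union> F))] \<cdot>\<^bsub>R\<^esub> ([k S] \<cdot>\<^bsub>R\<^esub> (wb \<otimes>\<^bsub>R\<^esub> w S)))"
    using wY wb w_insert[OF YG] B_Y
    by (intro finsum_cong') (auto simp: add.int_pow_pow mult.commute)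
  also have "(\<Oplus>\<^bsub>R\<^esub>S\<in>X. [?B S] \<cdot>\<^bsub>R\<^esub> w S) = (\<Oplus>\<^bsub>R\<^esub>S\<in>X. [\<chi> S] \<cdot>\<^bsub>R\<^esub> w S \<oplus>\<^bsub>R\<^esub>
      (if S \<in> Y then [(\<chi> (S \<union> F))] \<cdot>\<^bsub>R\<^esub> ([(k S - 1)] \<cdot>\<^bsub>R\<^esub> w S) else \<zero>\<^bsub>R\<^esub>))"
    using wX B_X by (intro finsum_cong') (auto simp: add.int_pow_pow add.int_pow_mult add_pow_int_0 mult.commute)
  also have "\<dots> = (\<Oplus>\<^bsub>R\<^esub>S\<in>X. [\<chi> S] \<cdot>\<^bsub>R\<^esub> w S) \<oplus>\<^bsub>R\<^esub> (\<Oplus>\<^bsub>R\<^esub>S\<in>X.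
      if S \<in> Y then [(\<chi> (S \<union> F))] \<cdot>\<^bsub>R\<^esub> ([(k S - 1)] \<cdot>\<^bsub>R\<^esub> w S) else \<zero>\<^bsub>R\<^esub>)"
    using wX by (intro finsum_addf) auto
  also have "(\<Oplus>\<^bsub>R\<^esub>S\<in>X. if S \<in> Y then [(\<chi> (S \<union> F))] \<cdot>\<^bsub>R\<^esub> ([(k S - 1)] \<cdot>\<^bsub>R\<^esub> w S) else \<zero>\<^bsub>R\<^esub>)
      = (\<Oplus>\<^bsub>R\<^esub>S\<in>Y. [(\<chi> (S \<union> F))] \<cdot>\<^bsub>R\<^esub> ([(k S - 1)] \<cdot>\<^bsub>R\<^esub> w S))"
    using wX YX by (intro add.finprod_mono_neutral_cong_right) auto
  also have "(\<Oplus>\<^bsub>R\<^esub>S\<in>X. [\<chi> S] \<cdot>\<^bsub>R\<^esub> w S) \<oplus>\<^bsub>R\<^esub> (\<Oplus>\<^bsub>R\<^esub>S\<in>Y. [(\<chi> (S \<union> F))] \<cdot>\<^bsub>R\<^esub> ([(k S - 1)] \<cdot>\<^bsub>R\<^esub> w S)) \<oplus>\<^bsub>R\<^esub>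
      (\<Oplus>\<^bsub>R\<^esub>S\<in>Y. [(\<chi> (S \<union> F))] \<cdot>\<^bsub>R\<^esub> ([k S] \<cdot>\<^bsub>R\<^esub> (wb \<otimes>\<^bsub>R\<^esub> w S)))
      = (\<Oplus>\<^bsub>R\<^esub>S\<in>X. [\<chi> S] \<cdot>\<^bsub>R\<^esub> w S) \<oplus>\<^bsub>R\<^esub>
        ((\<Oplus>\<^bsub>R\<^esub>S\<in>Y. [(\<chi> (S \<union> F))] \<cdot>\<^bsub>R\<^esub> ([(k S - 1)] \<cdot>\<^bsub>R\<^esub> w S)) \<oplus>\<^bsub>R\<^esub>
         (\<Oplus>\<^bsub>R\<^esub>S\<in>Y. [(\<chi> (S \<union> F))] \<cdot>\<^bsub>R\<^esub> ([k S] \<cdot>\<^bsub>R\<^esub> (wb \<otimes>\<^bsub>R\<^esub> w S))))"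
    using wX wY wb by (intro a_assoc finsum_closed) auto
  also have "(\<Oplus>\<^bsub>R\<^esub>S\<in>Y. [(\<chi> (S \<union> F))] \<cdot>\<^bsub>R\<^esub> ([(k S - 1)] \<cdot>\<^bsub>R\<^esub> w S)) \<oplus>\<^bsub>R\<^esub>
      (\<Oplus>\<^bsub>R\<^esub>S\<in>Y. [(\<chi> (S \<union> F))] \<cdot>\<^bsub>R\<^esub> ([k S] \<cdot>\<^bsub>R\<^esub> (wb \<otimes>\<^bsub>R\<^esub> w S)))
      = (\<Oplus>\<^bsub>R\<^esub>S\<in>Y. [(\<chi> (S \<union> F))] \<cdot>\<^bsub>R\<^esub> ([(k S - 1)] \<cdot>\<^bsub>R\<^esub> w S) \<oplus>\<^bsub>R\<^esub>
          [(\<chi> (S \<union> F))] \<cdot>\<^bsub>R\<^esub> ([k S] \<cdot>\<^bsub>R\<^esub> (wb \<otimes>\<^bsub>R\<^esub> w S)))"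
    using wY wb by (intro finsum_addf[symmetric]) auto
  also have "\<dots> = (\<Oplus>\<^bsub>R\<^esub>S\<in>Y. [(\<chi> (S \<union> F))] \<cdot>\<^bsub>R\<^esub> h S)"
    using wY wb unfolding h_def by (intro finsum_cong') (auto simp: add.int_pow_distrib)
  also have "\<dots> = (\<Oplus>\<^bsub>R\<^esub>T\<in>{T \<in> N. F \<subseteq> T}. [\<chi> T] \<cdot>\<^bsub>R\<^esub> w T)"
  proof -
    let ?I = "{T \<in> N. F \<subseteq> T}"
    \<comment> \<open>\<open>Y\<close> is partitioned according to \<open>T = S \<union> F\<close>.
      The part belonging to \<open>T\<close> is parametrized by the proper subsets
      \<open>P = S \<inter> F\<close> of \<open>F\<close>.\<close>
    let ?A = "\<lambda>T. (\<union>) (T - F) ` (Pow F - {F})"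
    have Y_eq: "Y = (\<Union>T\<in>?I. ?A T)"
    proof
      show "Y \<subseteq> (\<Union>T\<in>?I. ?A T)"
      proof
        fix S assume S: "S \<in> Y"
        have "S = (S \<union> F - F) \<union> (S \<inter> F)" by auto
        moreover have "S \<inter> F \<in> Pow F - {F}" "S \<union> F \<in> ?I" using S unfolding Y_def by auto
        ultimately show "S \<in> (\<Union>T\<in>?I. ?A T)" by blast
      qed
      show "(\<Union>T\<in>?I. ?A T) \<subseteq> Y"
      proof
        fix S assume "S \<in> (\<Union>T\<in>?I. ?A T)"
        then obtain T P where *: "T \<in> N" "F \<subseteq> T" "P \<subseteq> F" "P \<noteq> F" "S = (T - F) \<union> P" by auto
        then have "S \<union> F = T" by auto
        moreover have "\<not> F \<subseteq> S" using * by auto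
        ultimately show "S \<in> Y" unfolding Y_def using *(1) by simp
      qed
    qed
    have "(\<Oplus>\<^bsub>R\<^esub>S\<in>Y. [(\<chi> (S \<union> F))] \<cdot>\<^bsub>R\<^esub> h S)
        = (\<Oplus>\<^bsub>R\<^esub>T\<in>?I. \<Oplus>\<^bsub>R\<^esub>S\<in>?A T. [(\<chi> (S \<union> F))] \<cdot>\<^bsub>R\<^esub> h S)"
      unfolding Y_eq
    proof (rule add.finprod_UN_disjoint)
      have "S \<union> F = T" if "S \<in> ?A T" "T \<in> ?I" for S T using that by auto
      then show "pairwise (\<lambda>T T'. disjnt (?A T) (?A T')) ?I"
        unfolding pairwise_def disjnt_iff by metis
      show "[(\<chi> (S \<union> F))] \<cdot>\<^bsub>R\<^esub> h S \<in> carrier R" if "T \<in> ?I" "S \<in> ?A T" for T S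
      proof -
        have "S \<in> Y" unfolding Y_eq using that by blast
        then show ?thesis using h YG by simp
      qed
    qed auto
    also have "\<dots> = (\<Oplus>\<^bsub>R\<^esub>T\<in>?I. [\<chi> T] \<cdot>\<^bsub>R\<^esub> w T)"
    proof (intro finsum_cong' refl funcsetI)
      fix T assume T: "T \<in> ?I"
      then show "[\<chi> T] \<cdot>\<^bsub>R\<^esub> w T \<in> carrier R" using wN by simp
      have TG: "T - F \<subseteq> G\<^sub>1" using T NG by blast
      have PG: "P \<subseteq> G\<^sub>1" "(T - F) \<union> P \<subseteq> G\<^sub>1" if "P \<in> Pow F - {F}" for P
        using that FG TG by blast+
      \<comment> \<open>The number \<open>k\<close> depends only on the intersection with
        \<open>F\<close>, and \<open>w\<close> is multiplicative on disjoint unions. So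
        \<open>w (T - F)\<close> factors out, leaving a sum that involves \<open>F\<close>
        alone.\<close>
      have hP: "h ((T - F) \<union> P) = w (T - F) \<otimes>\<^bsub>R\<^esub> h P" if P: "P \<in> Pow F - {F}" for P
      proof -
        have "k ((T - F) \<union> P) = k P" unfolding k_def by (rule arg_cong[where f = "\<lambda>A. int (card A)"]) auto
        moreover have "w ((T - F) \<union> P) = w (T - F) \<otimes>\<^bsub>R\<^esub> w P"
          using P by (intro w_Un TG PG) auto
        ultimately show ?thesis
          unfolding h_def using w[OF TG] w[OF PG(1)[OF P]] wb
          by (simp add: r_distr add_pow_rdistr_int m_lcomm)
      qed
      have "(\<Oplus>\<^bsub>R\<^esub>S\<in>?A T. [(\<chi> (S \<union> F))] \<cdot>\<^bsub>R\<^esub> h S)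
          = (\<Oplus>\<^bsub>R\<^esub>P\<in>Pow F - {F}. [(\<chi> ((T - F) \<union> P \<union> F))] \<cdot>\<^bsub>R\<^esub> h ((T - F) \<union> P))"
      proof (intro finsum_reindex)
        show "inj_on ((\<union>) (T - F)) (Pow F - {F})" by (auto simp: inj_on_def)
        show "(\<lambda>S. [(\<chi> (S \<union> F))] \<cdot>\<^bsub>R\<^esub> h S) \<in> ?A T \<rightarrow> carrier R"
          using h[OF PG(2)] by auto
      qed
      also have "\<dots> = (\<Oplus>\<^bsub>R\<^esub>P\<in>Pow F - {F}. [\<chi> T] \<cdot>\<^bsub>R\<^esub> (w (T - F) \<otimes>\<^bsub>R\<^esub> h P))"
      proof (intro finsum_cong' refl funcsetI)
        fix P assume P: "P \<in> Pow F - {F}"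
        have "(T - F) \<union> P \<union> F = T" using T P by auto
        then show "[(\<chi> ((T - F) \<union> P \<union> F))] \<cdot>\<^bsub>R\<^esub> h ((T - F) \<union> P)
            = [\<chi> T] \<cdot>\<^bsub>R\<^esub> (w (T - F) \<otimes>\<^bsub>R\<^esub> h P)" using hP[OF P] by simp
        show "[\<chi> T] \<cdot>\<^bsub>R\<^esub> (w (T - F) \<otimes>\<^bsub>R\<^esub> h P) \<in> carrier R"
          using w[OF TG] h[OF PG(1)[OF P]] by simp
      qed
      also have "\<dots> = [\<chi> T] \<cdot>\<^bsub>R\<^esub> (w (T - F) \<otimes>\<^bsub>R\<^esub> (\<Oplus>\<^bsub>R\<^esub>P\<in>Pow F - {F}. h P))"
        using w[OF TG] h[OF PG(1)]
        by (subst finsum_int_scale[symmetric]) (auto simp: finsum_rdistr Pi_def)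
      also have "(\<Oplus>\<^bsub>R\<^esub>P\<in>Pow F - {F}. h P) = w F"
        unfolding h_def w_def wb_def k_def
      proof (rule blowup_weight_identity)
        show "\<alpha> \<in> F \<rightarrow> Units R" "\<alpha> b \<in> Units R" using assms(6) FG G2 by auto
        show "\<alpha> b = (\<Oplus>\<^bsub>R\<^esub>i\<in>F. \<alpha> i)" unfolding F_def by (rule assms(7))
      qed simp
      also have "w (T - F) \<otimes>\<^bsub>R\<^esub> w F = w T"
      proof -
        have "w ((T - F) \<union> F) = w (T - F) \<otimes>\<^bsub>R\<^esub> w F" by (intro w_Un TG FG) auto
        moreover have "(T - F) \<union> F = T" using T by blast
        ultimately show ?thesis by (simp only:)
      qed
      finally show "(\<Oplus>\<^bsub>R\<^esub>S\<in>?A T. [(\<chi> (S \<union> F))] \<cdot>\<^bsub>R\<^esub> h S) = [\<chi> T] \<cdot>\<^bsub>R\<^esub> w T" .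
    qed
    finally show ?thesis .
  qed
  finally show ?thesis unfolding Z1' by simp
qed

end
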